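(* Let $k \ge 0$ be an integer and let $S\subset\mathbb{R}^2$ be a nonempty generic point set. Then there is a subset $P\subseteq S$ that is a $k$-modal path and satisfies $$|P| \ \ge\ \Bigl\lceil \sqrt{(2k+1)\bigl(|S|-\tfrac14\bigr)} - \tfrac{k}{2} \Bigr\rceil .$$
   Context: For $p=(a,b)\in\mathbb{R}^2$ write $x(p)=a$, $y(p)=b$. A finite set $S\subset\mathbb{R}^2$ is generic if $x(p)\ne x(q)$ and $y(p)\neq y(q)$ for all distinct $p,q\in S$. A finite set of points is an increasing path if any two distinct points $p,q$ of it with $x(p)\le x(q)$ satisfy $x(p)<x(q)$ and $y(p)<y(q)$; it is a decreasing path if any two distinct points $p,q$ of it with $x(p)\le x(q)$ satisfy $x(p)<x(q)$ and $y(p)>y(q)$ (so the empty set and one-point sets are both). A $(k+1)$-partition of a finite set $S$ is a tuple $(S_0,\dots,S_k)$ of possibly empty sets with $S=S_0\cup\dots\cup S_k$ and $\max_{p\in S_i}x(p)<\min_{q\in S_j}x(q)$ whenever $0\le i<j\le k$ (with $\max_\varnothing=-\infty$, $\min_\varnothing=+\infty$). A generic set $P$ is a $k$-modal path if it admits a $(k+1)$-partition $(P_0,\dots,P_k)$ such that either all $P_i$ with $i$ even are increasing paths and all $P_i$ with $i$ odd are decreasing paths, or all $P_i$ with $i$ even are decreasing paths and all $P_i$ with $i$ odd are increasing paths. Its length is $|P|$. *)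

theory Defs
  imports Complex_Main "HOL-Library.Extended_Real"
begin

type_synonym point = "real \<times> real"

definition generic :: "point set \<Rightarrow> bool" where
  "generic S \<longleftrightarrow> finite S \<and>
     (\<forall>p\<in>S. \<forall>q\<in>S. p \<noteq> q \<longrightarrow> fst p \<noteq> fst q \<and> snd p \<noteq> snd q)"

definition increasing_path :: "point set \<Rightarrow> bool" where
  "increasing_path P \<longleftrightarrow> finite P \<and>
     (\<forall>p\<in>P. \<forall>q\<in>P. p \<noteq> q \<and> fst p \<le> fst q \<longrightarrow> fst p < fst q \<and> snd p < snd q)"

definition decreasing_path :: "point set \<Rightarrow> bool" where
  "decreasing_path P \<longleftrightarrow> finite P \<and>
     (\<forall>p\<in>P. \<forall>q\<in>P. p \<noteq> q \<and> fst p \<le> fst q \<longrightarrow> fst p < fst q \<and> snd p > snd q)"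

text \<open>
  A partition of \<open>S\<close> into \<open>k + 1\<close> possibly empty parts is a family \<open>A\<close> of which only the
  values at indices up to \<open>k\<close> matter. On finite sets the supremum and infimum in the extended
  reals are the maximum and minimum, with the conventions \<open>max \<emptyset> = -\<infinity>\<close> and \<open>min \<emptyset> = +\<infinity>\<close>.
\<close>

definition vertical_partition :: "nat \<Rightarrow> point set \<Rightarrow> (nat \<Rightarrow> point set) \<Rightarrow> bool" where
  "vertical_partition k S A \<longleftrightarrow> S = (\<Union>i\<le>k. A i) \<and>
     (\<forall>i j. i < j \<and> j \<le> k \<longrightarrow> (SUP p\<in>A i. ereal (fst p)) < (INF q\<in>A j. ereal (fst q)))"

definition modal_path :: "nat \<Rightarrow> point set \<Rightarrow> bool" where
  "modal_path k P \<longleftrightarrow> generic P \<and>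
     (\<exists>A. vertical_partition k P A \<and>
       ((\<forall>i\<le>k. (even i \<longrightarrow> increasing_path (A i)) \<and> (odd i \<longrightarrow> decreasing_path (A i))) \<or>
        (\<forall>i\<le>k. (even i \<longrightarrow> decreasing_path (A i)) \<and> (odd i \<longrightarrow> increasing_path (A i)))))"

lemma SUP_less_INF_finite_iff:
  fixes A B :: "point set"
  assumes "finite A" "finite B"
  shows "(SUP p\<in>A. ereal (fst p)) < (INF q\<in>B. ereal (fst q)) \<longleftrightarrow>
    (\<forall>p\<in>A. \<forall>q\<in>B. fst p < fst q)"
proof
  assume *: "(SUP p\<in>A. ereal (fst p)) < (INF q\<in>B. ereal (fst q))"
  show "\<forall>p\<in>A. \<forall>q\<in>B. fst p < fst q"
  proof (intro ballI)
    fix p q assume "p \<in> A" "q \<in> B"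
    then have "ereal (fst p) \<le> (SUP p\<in>A. ereal (fst p))" "(INF q\<in>B. ereal (fst q)) \<le> ereal (fst q)"
      by (auto intro: SUP_upper INF_lower)
    with * have "ereal (fst p) < ereal (fst q)" by order
    then show "fst p < fst q" by simp
  qed
next
  assume *: "\<forall>p\<in>A. \<forall>q\<in>B. fst p < fst q"
  have bot: "(SUP p\<in>A. ereal (fst p)) < x" if "A = {}" "x \<noteq> -\<infinity>" for x
    using that by (simp add: bot_ereal_def)
  have attA: "(SUP p\<in>A. ereal (fst p)) \<in> (\<lambda>p. ereal (fst p)) ` A" if "A \<noteq> {}"
    using that assms(1) Max_in[of "(\<lambda>p. ereal (fst p)) ` A"] by (simp add: Max_Sup)
  have attB: "(INF q\<in>B. ereal (fst q)) \<in> (\<lambda>p. ereal (fst p)) ` B" if "B \<noteq> {}"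
    using that assms(2) Min_in[of "(\<lambda>p. ereal (fst p)) ` B"] by (simp add: Min_Inf)
  show "(SUP p\<in>A. ereal (fst p)) < (INF q\<in>B. ereal (fst q))"
  proof (cases "B = {}")
    case True
    then show ?thesis using attA by (cases "A = {}") (auto simp: top_ereal_def bot_ereal_def)
  next
    case False
    then obtain q where q: "q \<in> B" "(INF q\<in>B. ereal (fst q)) = ereal (fst q)"
      using attB by blast
    show ?thesis
    proof (cases "A = {}")
      case True
      then show ?thesis using q(2) bot by simp
    next
      case False
      then obtain p where "p \<in> A" "(SUP p\<in>A. ereal (fst p)) = ereal (fst p)"
        using attA by blast
      then show ?thesis using q * by simp
    qed
  qed
qed

end

theory Submission
  imports Defs "HOL-Library.Product_Lexorder"
begin

text \<open>
  Attach to every point of a modal path the number (phase) of the part containing it, with even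
  phases increasing and odd ones decreasing. Modal paths become chains that increase in the
  \<open>x\<close>-coordinate and, lexicographically, in (phase, \<open>\<plusminus>y\<close>). Let \<open>L(i,j)\<close> be the maximal length of a
  chain with phases in \<open>{i..j}\<close>. Cutting two chains and exchanging their ends gives
  \<open>L(i,j) + L(i',j') \<le> L(i,j') + L(i',j)\<close> for \<open>i \<le> i' \<le> j' + 1\<close> and \<open>j' \<le> j\<close>, hence the sum
  \<open>\<sigma>(m) = L(0,m) + L(1,m+1)\<close> over the two starting directions is concave in \<open>m\<close>.

  Let \<open>c\<close> be the slope of \<open>\<sigma>\<close> at \<open>k\<close> and \<open>T = \<sigma>(k) - k c\<close>. Allow any number of direction
  changes, but charge \<open>g\<close> for a change to decreasing and \<open>h = c - g\<close> for a change to increasing.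
  As in the Erdos-Szekeres argument, label each point by the best scores \<open>(X,Z)\<close> of paths that
  end there in increasing resp. decreasing mode. The labels are distinct, and since one may
  switch mode at the point itself, \<open>-h \<le> X - Z \<le> g\<close>. For a suitable \<open>g\<close> the maxima \<open>A\<close> and \<open>B\<close> of
  \<open>X\<close> and \<open>Z\<close> satisfy \<open>A + B \<le> T\<close>, so the labels lie in a hexagon, and counting its lattice points
  yields \<open>4 |S| \<le> (c + 1) (2 T - c - 1) + 1\<close>. Completing the square in \<open>c\<close> eliminates \<open>c\<close>.
\<close>

section \<open>Phased chains and their maximal lengths\<close>

definition key :: "nat \<times> point \<Rightarrow> nat \<times> real" where
  "key a = (fst a, if even (fst a) then snd (snd a) else - snd (snd a))"

definition prec :: "nat \<times> point \<Rightarrow> nat \<times> point \<Rightarrow> bool" where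
  "prec a b \<longleftrightarrow> fst (snd a) < fst (snd b) \<and> key a < key b"

text \<open>Phases may be skipped, which accounts for empty parts. For \<open>j < i\<close> only the
  empty chain remains, so exchanges may involve an empty interval.\<close>

definition phased_chain :: "point set \<Rightarrow> nat \<Rightarrow> nat \<Rightarrow> (nat \<times> point) set \<Rightarrow> bool" where
  "phased_chain S i j C \<longleftrightarrow> C \<subseteq> {i..j} \<times> S \<and> (\<forall>a\<in>C. \<forall>b\<in>C. a \<noteq> b \<longrightarrow> prec a b \<or> prec b a)"

definition longest :: "point set \<Rightarrow> nat \<Rightarrow> nat \<Rightarrow> nat" where
  "longest S i j = Max (card ` {C. phased_chain S i j C})"

lemma key_fst_mono: "key a \<le> key b \<Longrightarrow> fst a \<le> fst b"
  by (auto simp: key_def less_eq_prod_def)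

lemma key_less_if_fst_less: "fst a < fst b \<Longrightarrow> key a < key b"
  by (auto simp: key_def less_prod_def)

lemma prec_trans: "prec a b \<Longrightarrow> prec b c \<Longrightarrow> prec a c"
  unfolding prec_def by (meson less_trans)

lemma prec_irrefl: "\<not> prec a a"
  by (simp add: prec_def)

lemma key_maximal:
  assumes "finite C" "C \<noteq> {}"
  shows "\<exists>e\<in>C. \<forall>b\<in>C. key b \<le> key e"
proof -
  have "Max (key ` C) \<in> key ` C" using assms by (intro Max_in) auto
  then obtain e where "e \<in> C" "Max (key ` C) = key e" by blast
  then show ?thesis using assms(1) by (metis Max_ge finite_imageI imageI)
qed

lemma phased_chain_finite: "finite S \<Longrightarrow> phased_chain S i j C \<Longrightarrow> finite C"
  unfolding phased_chain_def by (meson finite_SigmaI finite_atLeastAtMost finite_subset)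

lemma finite_phased_chains: "finite S \<Longrightarrow> finite {C. phased_chain S i j C}"
  unfolding phased_chain_def
  by (rule finite_subset[of _ "Pow ({i..j} \<times> S)"]) auto

lemma phased_chain_empty: "phased_chain S i j {}"
  by (simp add: phased_chain_def)

lemma card_le_longest: "finite S \<Longrightarrow> phased_chain S i j C \<Longrightarrow> card C \<le> longest S i j"
  unfolding longest_def using finite_phased_chains[of S i j] by (intro Max_ge) auto

lemma longest_attained:
  assumes "finite S"
  obtains C where "phased_chain S i j C" "card C = longest S i j"
proof -
  have "longest S i j \<in> card ` {C. phased_chain S i j C}"
    unfolding longest_def using finite_phased_chains[OF assms] by (intro Max_in) (auto intro: phased_chain_empty)
  then show ?thesis using that by auto
qed

lemma phased_chain_mono:
  "phased_chain S i j C \<Longrightarrow> i' \<le> i \<Longrightarrow> j \<le> j' \<Longrightarrow> phased_chain S i' j' C"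
  unfolding phased_chain_def by (auto dest!: subsetD)

lemma phased_chain_subset: "phased_chain S i j C \<Longrightarrow> D \<subseteq> C \<Longrightarrow> D \<subseteq> {i'..j'} \<times> UNIV \<Longrightarrow> phased_chain S i' j' D"
  unfolding phased_chain_def by blast

lemma longest_mono:
  assumes "finite S" "i' \<le> i" "j \<le> j'"
  shows "longest S i j \<le> longest S i' j'"
  using assms by (metis card_le_longest longest_attained phased_chain_mono)

lemma phased_chain_Un:
  assumes "phased_chain S i j C" "phased_chain S i j D" "\<And>a b. a \<in> C \<Longrightarrow> b \<in> D \<Longrightarrow> prec a b"
  shows "phased_chain S i j (C \<union> D)" "C \<inter> D = {}"
  using assms prec_irrefl unfolding phased_chain_def by blast+

lemma phased_chain_memD: "phased_chain S i j C \<Longrightarrow> a \<in> C \<Longrightarrow> i \<le> fst a \<and> fst a \<le> j \<and> snd a \<in> S"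
  unfolding phased_chain_def by auto

lemma phased_chain_compare:
  assumes "phased_chain S i j C" "a \<in> C" "b \<in> C"
  shows "a = b \<or> (prec a b \<and> key a < key b) \<or> (prec b a \<and> key b < key a)"
  using assms unfolding phased_chain_def prec_def by blast

text \<open>At a suitable cut the lower part of \<open>A\<close> continues with the upper part of
  \<open>B\<close>, using phases \<open>i..j'\<close>, and the lower part of \<open>B\<close> with
  the upper part of \<open>A\<close>, using phases \<open>i'..j\<close>. Irreflexivity of
  \<open>prec\<close> makes both unions disjoint, so no length is lost.\<close>

lemma phased_chain_exchange:
  assumes fin: "finite S" and A: "phased_chain S i j A" and B: "phased_chain S i' j' B"
    and "i \<le> i'" "i' \<le> Suc j'" "j' \<le> j"
  obtains A' B' where "phased_chain S i j' A'" "phased_chain S i' j B'"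
    "card A + card B = card A' + card B'"
proof -
  note result = that
  define x where "x a = fst (snd a)" for a :: "nat \<times> point"
  have main: thesis
    if cut: "A = A1 \<union> A2" "A1 \<inter> A2 = {}" "B = B1 \<union> B2" "B1 \<inter> B2 = {}"
      and ch: "phased_chain S i j' A1" "phased_chain S i' j A2"
      and p1: "\<And>a b. a \<in> A1 \<Longrightarrow> b \<in> B2 \<Longrightarrow> prec a b" and p2: "\<And>a b. a \<in> B1 \<Longrightarrow> b \<in> A2 \<Longrightarrow> prec a b"
    for A1 A2 B1 B2
  proof (rule result)
    have B2: "phased_chain S i j' B2" and B1: "phased_chain S i' j B1"
      using B \<open>i \<le> i'\<close> \<open>j' \<le> j\<close> cut(3) by (fastforce simp: phased_chain_def)+
    show "phased_chain S i j' (A1 \<union> B2)" by (rule phased_chain_Un(1)[OF ch(1) B2 p1])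
    show "phased_chain S i' j (B1 \<union> A2)" by (rule phased_chain_Un(1)[OF B1 ch(2) p2])
    have d: "A1 \<inter> B2 = {}" "B1 \<inter> A2 = {}"
      using phased_chain_Un(2)[OF ch(1) B2 p1] phased_chain_Un(2)[OF B1 ch(2) p2] by blast+
    have f: "finite A1" "finite A2" "finite B1" "finite B2"
      using phased_chain_finite[OF fin] ch B1 B2 by blast+
    show "card A + card B = card (A1 \<union> B2) + card (B1 \<union> A2)"
      using f d cut by (simp add: card_Un_disjoint)
  qed
  txt \<open>
    \<open>E\<close> consists of the elements of \<open>B\<close> lying above and to the left of \<open>A\<close>; both chains are cut at
    the key of its largest element, or below all of \<open>B\<close> if there is none.
  \<close>
  define E where "E = {e \<in> B. \<exists>z\<in>A. x e \<le> x z \<and> key z \<le> key e}"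
  have finE: "finite E" unfolding E_def using phased_chain_finite[OF fin B] by auto
  show thesis
  proof (cases "E = {}")
    case True
    show thesis
    \<comment> \<open>Since \<open>i' <= Suc j'\<close>, phases below \<open>i'\<close> are at most
      \<open>j'\<close>. They precede all phases of \<open>B\<close>, so an element of
      \<open>B\<close> weakly left of such a point would lie in \<open>E\<close>.\<close>
    proof (rule main[of "{z\<in>A. fst z < i'}" "{z\<in>A. i' \<le> fst z}" "{}" B])
      show "phased_chain S i j' {z \<in> A. fst z < i'}"
        by (rule phased_chain_subset[OF A]) (use A \<open>i' \<le> Suc j'\<close> in \<open>auto simp: phased_chain_def\<close>)
      show "phased_chain S i' j {z \<in> A. i' \<le> fst z}"
        by (rule phased_chain_subset[OF A]) (use A in \<open>auto simp: phased_chain_def\<close>)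
      fix a b assume a: "a \<in> {z \<in> A. fst z < i'}" and b: "b \<in> B"
      then have "fst a < fst b" using B by (auto simp: phased_chain_def)
      then have k: "key a < key b" by (rule key_less_if_fst_less)
      have "b \<in> E" if "x b \<le> x a" unfolding E_def using that a b less_imp_le[OF k] by auto
      then have "\<not> x b \<le> x a" using True by blast
      then show "prec a b" using k by (auto simp: prec_def x_def)
    qed auto
  next
    case False
    obtain e where e: "e \<in> E" "\<And>b. b \<in> E \<Longrightarrow> key b \<le> key e"
      using key_maximal[OF finE False] by blast
    then obtain z where z: "z \<in> A" "x e \<le> x z" "key z \<le> key e" and eB: "e \<in> B" by (auto simp: E_def)
    have eph: "i' \<le> fst e" "fst e \<le> j'" using eB B by (auto simp: phased_chain_def)
    show thesis
    proof (rule main[of "{z\<in>A. key z \<le> key e}" "{z\<in>A. key e < key z}" "{b\<in>B. key b \<le> key e}" "{b\<in>B. key e < key b}"])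
      have "i \<le> fst z" "fst z \<le> j" if "z \<in> A" for z using A that by (auto simp: phased_chain_def)
      then have ph: "fst z \<in> {i..j}" if "z \<in> A" for z using that by simp
      have lo: "fst z \<le> j'" if "key z \<le> key e" for z using key_fst_mono[OF that] eph by linarith
      have hi: "i' \<le> fst z" if "key e < key z" for z
        using key_fst_mono[OF less_imp_le[OF that]] eph by linarith
      show "phased_chain S i j' {z \<in> A. key z \<le> key e}"
        by (rule phased_chain_subset[OF A]) (use ph lo in auto)
      show "phased_chain S i' j {z \<in> A. key e < key z}"
        by (rule phased_chain_subset[OF A]) (use ph hi in auto)
    next
      fix a b assume a: "a \<in> {z \<in> A. key z \<le> key e}" and b: "b \<in> {b \<in> B. key e < key b}"
      \<comment> \<open>By maximality of \<open>e\<close>, larger keys lie outside \<open>E\<close>;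
        so \<open>b\<close> is strictly to the right of \<open>a\<close>.\<close>
      then have "b \<notin> E" using e(2) by fastforce
      then have "\<not> x b \<le> x a" using a b unfolding E_def by auto
      then show "prec a b" using a b by (auto simp: prec_def x_def)
    next
      fix b a assume b: "b \<in> {b \<in> B. key b \<le> key e}" and a: "a \<in> {z \<in> A. key e < key z}"
      \<comment> \<open>The witness \<open>z\<close> comes before \<open>a\<close> in
        \<open>A\<close>, and \<open>e\<close> is weakly left of \<open>z\<close>; so
        \<open>a\<close> is to the right of \<open>e\<close> and of everything before
        \<open>e\<close> in \<open>B\<close>.\<close>
      have "key z < key a" using a z(3) by (auto intro: le_less_trans)
      then have "prec z a" using phased_chain_compare[OF A z(1), of a] a by auto
      moreover have "b = e \<or> prec b e" using phased_chain_compare[OF B _ eB, of b] b by (auto simp: le_less)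
      ultimately show "prec b a" using a b z(2) by (auto simp: prec_def x_def)
    qed auto
  qed
qed

lemma longest_exchange:
  assumes "finite S" "i \<le> i'" "i' \<le> Suc j'" "j' \<le> j"
  shows "longest S i j + longest S i' j' \<le> longest S i j' + longest S i' j"
proof -
  obtain A where A: "phased_chain S i j A" "card A = longest S i j" by (rule longest_attained[OF assms(1)])
  obtain B where B: "phased_chain S i' j' B" "card B = longest S i' j'" by (rule longest_attained[OF assms(1)])
  obtain A' B' where "phased_chain S i j' A'" "phased_chain S i' j B'" "card A + card B = card A' + card B'"
    by (rule phased_chain_exchange[OF assms(1) A(1) B(1) assms(2-4)])
  then show ?thesis using A(2) B(2) card_le_longest[OF assms(1)] by (metis add_mono)
qed

text \<open>An exchange with the empty phase interval from \<open>Suc m\<close> to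
  \<open>m\<close>.\<close>

lemma longest_split:
  assumes "finite S" "i \<le> m" "m \<le> j"
  shows "longest S i j \<le> longest S i m + longest S (Suc m) j"
  using longest_exchange[of S i "Suc m" m j] assms by simp

text \<open>A shift by two keeps the parity of each phase, hence the sign in
  \<open>key\<close>.\<close>

lemma phased_chain_shift:
  "phased_chain S (i + 2) (j + 2) ((\<lambda>a. (fst a + 2, snd a)) ` C) \<longleftrightarrow> phased_chain S i j C"
proof -
  let ?f = "\<lambda>a::nat \<times> point. (fst a + 2, snd a)"
  have "prec (?f a) (?f b) \<longleftrightarrow> prec a b" for a b
    by (auto simp: prec_def key_def less_prod_def)
  moreover have "?f a = ?f b \<longleftrightarrow> a = b" for a b by (auto simp: prod_eq_iff)
  moreover have "?f ` C \<subseteq> {i + 2..j + 2} \<times> S \<longleftrightarrow> C \<subseteq> {i..j} \<times> S" by fastforce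
  ultimately show ?thesis unfolding phased_chain_def ball_simps by simp
qed

lemma longest_shift:
  assumes "finite S"
  shows "longest S (i + 2) (j + 2) = longest S i j"
proof (rule antisym)
  let ?f = "\<lambda>a::nat \<times> point. (fst a + 2, snd a)"
  have inj: "inj ?f" by (auto simp: inj_def)
  obtain C where C: "phased_chain S i j C" "card C = longest S i j" by (rule longest_attained[OF assms])
  then show "longest S i j \<le> longest S (i + 2) (j + 2)"
    using card_le_longest[OF assms, of "i + 2" "j + 2" "?f ` C"] phased_chain_shift[of S i j C] inj
    by (simp add: card_image inj_on_subset)
  obtain D where D: "phased_chain S (i + 2) (j + 2) D" "card D = longest S (i + 2) (j + 2)"
    by (rule longest_attained[OF assms])
  define C where "C = (\<lambda>a. (fst a - 2, snd a)) ` D"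
  have "D = ?f ` C"
  proof -
    have "(fst a - 2 + 2, snd a) = a" if "a \<in> D" for a
      using D(1) that by (fastforce simp: phased_chain_def prod_eq_iff)
    then show ?thesis unfolding C_def image_image by (simp add: image_def)
  qed
  then show "longest S (i + 2) (j + 2) \<le> longest S i j"
    using D inj phased_chain_shift[of S i j C] card_le_longest[OF assms, of i j C]
    by (simp add: card_image inj_on_subset)
qed

section \<open>Concavity of the sum over both starting directions\<close>

definition twin_sum :: "point set \<Rightarrow> nat \<Rightarrow> int" where
  "twin_sum S m = int (longest S 0 m) + int (longest S 1 (Suc m))"

text \<open>Each exchange keeps \<open>a + b\<close> and lowers the distance of the two arguments by
  two, until they agree.\<close>

lemma longest_pair_le_twin_sum:
  assumes "finite S"
  shows "even (a + b) \<Longrightarrow> int (longest S 0 a) + int (longest S 1 (Suc b)) \<le> twin_sum S ((a + b) div 2)"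
proof (induction "nat \<bar>int a - int b\<bar>" arbitrary: a b rule: less_induct)
  case less
  consider "a = b" | "b + 2 \<le> a" | "a + 2 \<le> b"
    using less.prems by (cases "a = Suc b"; cases "b = Suc a"; linarith?) auto
  then show ?case
  proof cases
    case 1
    then show ?thesis by (simp add: twin_sum_def)
  next
    case 2
    have "int (longest S 0 a) + int (longest S 1 (Suc b)) \<le> int (longest S 0 (Suc b)) + int (longest S 1 a)"
      using longest_exchange[OF assms, of 0 1 "Suc b" a] 2 by linarith
    also have "\<dots> \<le> twin_sum S ((Suc b + (a - 1)) div 2)"
      using less.hyps[of "Suc b" "a - 1"] 2 less.prems by (auto simp: of_nat_diff)
    finally show ?thesis using 2 by (simp add: add.commute)
  next
    case 3
    \<comment> \<open>Phases \<open>0..a\<close> are first raised to \<open>2..a + 2\<close>, which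
      is nested in \<open>1..Suc b\<close>; after the exchange \<open>2..Suc b\<close> is lowered
      again.\<close>
    have "int (longest S 0 a) + int (longest S 1 (Suc b))
        \<le> int (longest S 0 (b - 1)) + int (longest S 1 (Suc (Suc a)))"
      using longest_exchange[OF assms, of 1 2 "a + 2" "Suc b"] 3
        longest_shift[OF assms, of 0 a] longest_shift[OF assms, of 0 "b - 1"]
      by (simp add: numeral_2_eq_2)
    also have "\<dots> \<le> twin_sum S ((b - 1 + Suc a) div 2)"
    proof (rule less.hyps)
      show "nat \<bar>int (b - 1) - int (Suc a)\<bar> < nat \<bar>int a - int b\<bar>" using 3 by linarith
      show "even (b - 1 + Suc a)" using 3 less.prems by presburger
    qed
    finally show ?thesis using 3 by (simp add: add.commute)
  qed
qed

text \<open>The pairs \<open>(m + 2, m)\<close> and \<open>(m, m + 2)\<close> both have mean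
  \<open>m + 1\<close>; together they contain the four lengths on the left.\<close>

lemma twin_sum_concave:
  assumes "finite S"
  shows "twin_sum S m + twin_sum S (Suc (Suc m)) \<le> 2 * twin_sum S (Suc m)"
  using longest_pair_le_twin_sum[OF assms, of "Suc (Suc m)" m]
    longest_pair_le_twin_sum[OF assms, of m "Suc (Suc m)"]
  by (simp add: twin_sum_def)

lemma concave_increments:
  fixes f :: "nat \<Rightarrow> int"
  assumes "\<And>m. f m + f (Suc (Suc m)) \<le> 2 * f (Suc m)" "m \<le> n"
  shows "f (Suc n) - f n \<le> f (Suc m) - f m"
  using assms(2) by (rule lift_Suc_antimono_le[of "\<lambda>m. f (Suc m) - f m", rotated]) (smt (verit) assms(1))

lemma concave_le_tangent:
  fixes f :: "nat \<Rightarrow> int"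
  assumes "\<And>m. f m + f (Suc (Suc m)) \<le> 2 * f (Suc m)"
  shows "f m \<le> f k + (int m - int k) * (f (Suc k) - f k)"
proof (cases "k \<le> m")
  case True
  then show ?thesis
  proof (induction m rule: dec_induct)
    case (step m)
    then show ?case using concave_increments[of f k m] assms by (simp add: algebra_simps)
  qed simp
next
  case False
  then have "m \<le> k" by simp
  then show ?thesis
  proof (induction m rule: inc_induct)
    case (step m)
    then show ?case using concave_increments[of f m k] assms by (simp add: algebra_simps)
  qed simp
qed

section \<open>Scores with charges, and labels of points\<close>

text \<open>
  The charge for reaching phase \<open>j\<close> from phase 0; a chain starting in phase 1 is refunded
  \<open>weight c g 1 = g\<close>, since both directions may be started for free.
\<close>

definition weight :: "int \<Rightarrow> int \<Rightarrow> nat \<Rightarrow> int" where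
  "weight c g j = int (j div 2) * c + (if odd j then g else 0)"

definition ends_at :: "(nat \<times> point) set \<Rightarrow> nat \<times> point \<Rightarrow> bool" where
  "ends_at C e \<longleftrightarrow> e \<in> C \<and> (\<forall>a\<in>C. a = e \<or> prec a e)"

text \<open>The inequality makes the attained values downward closed. Starting phases 0 and 1
  suffice, as raising all phases by two leaves the score unchanged.\<close>

definition attains :: "point set \<Rightarrow> int \<Rightarrow> int \<Rightarrow> bool \<Rightarrow> point \<Rightarrow> nat \<Rightarrow> bool" where
  "attains S c g up p v \<longleftrightarrow> (\<exists>i j C. i \<le> 1 \<and> phased_chain S i j C \<and> ends_at C (j, p) \<and>
     even j = up \<and> int v \<le> int (card C) - weight c g j + weight c g i)"

definition label :: "point set \<Rightarrow> int \<Rightarrow> int \<Rightarrow> bool \<Rightarrow> point \<Rightarrow> nat" where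
  "label S c g up p = (GREATEST v. attains S c g up p v)"

lemma weight_Suc: "weight c g (Suc j) = weight c g j + (if even j then g else c - g)"
  by (cases "even j") (simp_all add: weight_def algebra_simps)

lemma weight_mono:
  assumes "0 \<le> g" "g \<le> c" "i \<le> j"
  shows "weight c g i \<le> weight c g j"
  by (rule lift_Suc_mono_le[OF _ assms(3)]) (use assms(1,2) in \<open>auto simp: weight_Suc\<close>)

lemma phased_chain_inj_on_snd: "phased_chain S i j C \<Longrightarrow> inj_on snd C"
  unfolding phased_chain_def inj_on_def prec_def by (metis less_irrefl)

lemma card_phased_chain_le: "finite S \<Longrightarrow> phased_chain S i j C \<Longrightarrow> card C \<le> card S"
  by (rule card_inj_on_le[OF phased_chain_inj_on_snd]) (auto simp: phased_chain_def)

lemma ends_atD: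
  assumes "ends_at C e"
  shows "e \<in> C" "a \<in> C \<Longrightarrow> a = e \<or> prec a e"
  using assms unfolding ends_at_def by blast+

lemma ends_at_exists:
  assumes "finite C" "C \<noteq> {}" "phased_chain S i j C"
  obtains e where "ends_at C e"
proof -
  obtain e where e: "e \<in> C" "\<And>b. b \<in> C \<Longrightarrow> key b \<le> key e"
    using key_maximal[OF assms(1,2)] by blast
  have "ends_at C e" unfolding ends_at_def
  proof (intro conjI ballI)
    fix a assume "a \<in> C"
    then show "a = e \<or> prec a e" using assms(3) e unfolding phased_chain_def prec_def by (meson leD)
  qed (rule e(1))
  then show thesis by (rule that)
qed

text \<open>The last element has the largest x-coordinate and key, so a later phase keeps it after
  all others. This models a change of direction at the point itself.\<close>

lemma raise_last_phase:
  assumes C: "phased_chain S i j C" and fin: "finite C" and e: "ends_at C (j', p)"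
  defines "D \<equiv> insert (j, p) (C - {(j', p)})"
  shows "phased_chain S i j D" "ends_at D (j, p)" "card D = card C"
proof -
  have mem: "(j', p) \<in> C" by (rule ends_atD(1)[OF e])
  have j': "j' \<le> j" "i \<le> j'" "p \<in> S" using phased_chain_memD[OF C mem] by simp_all
  have lt: "prec a (j, p)" if "a \<in> C - {(j', p)}" for a
  proof -
    have a: "prec a (j', p)" using that e unfolding ends_at_def by blast
    show ?thesis
    proof (cases "j' = j")
      case False
      have lt: "fst (snd a) < fst p" "key a < key (j', p)" using a by (auto simp only: prec_def snd_conv)
      have "fst a \<le> j'" using key_fst_mono[OF less_imp_le[OF lt(2)]] by simp
      then have "key a < key (j, p)" using False j'(1) by (intro key_less_if_fst_less) simp
      then show ?thesis using lt(1) by (simp only: prec_def snd_conv)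
    qed (use a in simp)
  qed
  then show "ends_at D (j, p)" by (auto simp: ends_at_def D_def)
  show "phased_chain S i j D"
    unfolding phased_chain_def
  proof (intro conjI ballI impI)
    show "D \<subseteq> {i..j} \<times> S" using C j' by (auto simp: phased_chain_def D_def)
    fix a b assume ab: "a \<in> D" "b \<in> D" "a \<noteq> b"
    then consider "a = (j, p)" "b \<in> C - {(j', p)}" | "b = (j, p)" "a \<in> C - {(j', p)}" | "a \<in> C" "b \<in> C"
      unfolding D_def by blast
    then show "prec a b \<or> prec b a"
    proof cases
      case 1
      then show ?thesis using lt[of b] by simp
    next
      case 2
      then show ?thesis using lt[of a] by simp
    next
      case 3
      then show ?thesis using phased_chain_compare[OF C, of a b] ab(3) by blast
    qed
  qed
  have "(j, p) \<notin> C - {(j', p)}" using lt[of "(j, p)"] prec_irrefl by blast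
  then have "card D = Suc (card (C - {(j', p)}))" using fin unfolding D_def by (intro card_insert_disjoint) auto
  then show "card D = card C" using card_Suc_Diff1[OF fin mem] by (rule trans)
qed

lemma append_to_phased_chain:
  assumes C: "phased_chain S i j C" and fin: "finite C" and e: "ends_at C e" and "prec e (j, q)" "q \<in> S"
  shows "phased_chain S i j (insert (j, q) C)" "ends_at (insert (j, q) C) (j, q)"
    "card (insert (j, q) C) = Suc (card C)"
proof -
  have lt: "prec a (j, q)" if "a \<in> C" for a
    using ends_atD(2)[OF e that] assms(4) prec_trans[of a e "(j, q)"] by metis
  then show "ends_at (insert (j, q) C) (j, q)" by (auto simp: ends_at_def)
  have "i \<le> j" using phased_chain_memD[OF C ends_atD(1)[OF e]] by simp
  then show "phased_chain S i j (insert (j, q) C)"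
    unfolding phased_chain_def
  proof (intro conjI ballI impI)
    show "insert (j, q) C \<subseteq> {i..j} \<times> S"
      using C \<open>i \<le> j\<close> \<open>q \<in> S\<close> by (simp add: phased_chain_def)
    fix a b assume ab: "a \<in> insert (j, q) C" "b \<in> insert (j, q) C" "a \<noteq> b"
    then consider "a = (j, q)" "b \<in> C" | "b = (j, q)" "a \<in> C" | "a \<in> C" "b \<in> C"
      by blast
    then show "prec a b \<or> prec b a"
    proof cases
      case 1
      then show ?thesis using lt[of b] by simp
    next
      case 2
      then show ?thesis using lt[of a] by simp
    next
      case 3
      then show ?thesis using phased_chain_compare[OF C, of a b] ab(3) by blast
    qed
  qed
  have "(j, q) \<notin> C" using lt[of "(j, q)"] prec_irrefl by blast
  then show "card (insert (j, q) C) = Suc (card C)" using fin by simp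
qed

text \<open>Charges only accumulate, so a score is at most the number of points. This bound makes
  \<open>GREATEST\<close> meaningful in \<open>label\<close>.\<close>

lemma attains_le_card:
  assumes "finite S" "0 \<le> g" "g \<le> c" "attains S c g up p v"
  shows "v \<le> card S"
proof -
  obtain i j C where C: "phased_chain S i j C" "ends_at C (j, p)"
    and v: "int v \<le> int (card C) - weight c g j + weight c g i"
    using assms(4) by (auto simp: attains_def)
  have "i \<le> j" using phased_chain_memD[OF C(1) ends_atD(1)[OF C(2)]] by simp
  then show ?thesis
    using weight_mono[OF assms(2,3)] v card_phased_chain_le[OF assms(1) C(1)] by fastforce
qed

lemma attains_1:
  assumes "p \<in> S"
  shows "attains S c g up p 1"
proof -
  \<comment> \<open>The chain starts and ends in the same phase, so charge and refund
    cancel.\<close>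
  define j where "j = (if up then 0 else 1 :: nat)"
  have "j \<le> 1" "phased_chain S j j {(j, p)}" "ends_at {(j, p)} (j, p)" "even j = up"
    using assms by (auto simp: j_def phased_chain_def ends_at_def)
  then show ?thesis unfolding attains_def by (intro exI[of _ j] exI[of _ "{(j, p)}"]) auto
qed

text \<open>If the last point has a phase below \<open>j\<close>, it is raised to \<open>j\<close>,
  the phase whose weight is charged.\<close>

lemma attains_last_point:
  assumes "finite S" "phased_chain S i j C" "C \<noteq> {}" "i \<le> 1"
    and "int v \<le> int (card C) - weight c g j + weight c g i"
  obtains p where "p \<in> S" "attains S c g (even j) p v"
proof -
  have fin: "finite C" using phased_chain_finite assms by blast
  obtain j' p where e: "ends_at C (j', p)"
    using ends_at_exists[OF fin assms(3,2)] by (metis surj_pair)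
  have "p \<in> S" using phased_chain_memD[OF assms(2) ends_atD(1)[OF e]] by simp
  moreover have "attains S c g (even j) p v"
    unfolding attains_def using raise_last_phase[OF assms(2) fin e] assms(4,5) by metis
  ultimately show thesis by (rule that)
qed

lemma attains_switch:
  assumes "finite S" "attains S c g up p v" "int w \<le> int v - (if up then g else c - g)"
  shows "attains S c g (\<not> up) p w"
proof -
  obtain i j C where C: "i \<le> 1" "phased_chain S i j C" "ends_at C (j, p)" "even j = up"
    and v: "int v \<le> int (card C) - weight c g j + weight c g i"
    using assms(2) by (auto simp: attains_def)
  have fin: "finite C" using phased_chain_finite assms(1) C(2) by blast
  have C': "phased_chain S i (Suc j) C" using C(2) by (rule phased_chain_mono) auto
  have "int w \<le> int (card C) - weight c g (Suc j) + weight c g i"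
    using v assms(3) C(4) by (simp add: weight_Suc)
  moreover have "even (Suc j) = (\<not> up)" using C(4) by simp
  ultimately show ?thesis
    unfolding attains_def using raise_last_phase[OF C' fin C(3)] C(1) by metis
qed

lemma attains_append:
  assumes "finite S" "attains S c g up p v" "q \<in> S" "fst p < fst q"
    and "if up then snd p < snd q else snd q < snd p"
  shows "attains S c g up q (Suc v)"
proof -
  obtain i j C where C: "i \<le> 1" "phased_chain S i j C" "ends_at C (j, p)" "even j = up"
    and v: "int v \<le> int (card C) - weight c g j + weight c g i"
    using assms(2) by (auto simp: attains_def)
  have fin: "finite C" using phased_chain_finite assms(1) C(2) by blast
  have "prec (j, p) (j, q)" using assms(4,5) C(4) by (auto simp: prec_def key_def less_prod_def split: if_splits)
  note D = append_to_phased_chain[OF C(2) fin C(3) this assms(3)]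
  have "int (Suc v) \<le> int (card (insert (j, q) C)) - weight c g j + weight c g i"
    using v D(3) by simp
  then show ?thesis unfolding attains_def using C(1,4) D(1,2) by blast
qed

text \<open>A path from phase 1 to an even phase ends in phase 2 or later, whence
  \<open>2 * a + 2\<close>; the term \<open>+ g\<close> is the refund.\<close>

lemma attains_up_bound:
  assumes "finite S" "attains S c g True p v"
  shows "(\<exists>a. int v \<le> int (longest S 0 (2 * a)) - int a * c) \<or>
    (\<exists>a. int v \<le> int (longest S 1 (2 * a + 2)) - (int a + 1) * c + g)"
proof -
  obtain i j C where C: "i \<le> 1" "phased_chain S i j C" "ends_at C (j, p)" "even j"
    and v: "int v \<le> int (card C) - weight c g j + weight c g i"
    using assms(2) by (auto simp: attains_def)
  have "i \<le> j" using phased_chain_memD[OF C(2) ends_atD(1)[OF C(3)]] by simp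
  have le: "card C \<le> longest S i j" by (rule card_le_longest[OF assms(1) C(2)])
  obtain a where a: "j = 2 * a" using C(4) by (rule evenE)
  consider "i = 0" | "i = 1" "a \<ge> 1" using C(1) \<open>i \<le> j\<close> a by linarith
  then show ?thesis
  proof cases
    case 1
    then show ?thesis using v le a by (auto simp: weight_def intro!: exI[of _ a])
  next
    case 2
    then obtain b where "a = Suc b" by (metis Suc_le_D One_nat_def)
    then show ?thesis using v le a 2 by (intro disjI2 exI[of _ b]) (auto simp: weight_def algebra_simps)
  qed
qed

lemma attains_down_bound:
  assumes "finite S" "attains S c g False p v"
  shows "(\<exists>a. int v \<le> int (longest S 0 (2 * a + 1)) - int a * c - g) \<or>
    (\<exists>a. int v \<le> int (longest S 1 (2 * a + 1)) - int a * c)"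
proof -
  obtain i j C where C: "i \<le> 1" "phased_chain S i j C" "odd j"
    and v: "int v \<le> int (card C) - weight c g j + weight c g i"
    using assms(2) by (auto simp: attains_def)
  have le: "card C \<le> longest S i j" by (rule card_le_longest[OF assms(1) C(2)])
  obtain a where a: "j = 2 * a + 1" using C(3) by (rule oddE)
  consider "i = 0" | "i = 1" using C(1) by linarith
  then show ?thesis
    by cases (use v le a in \<open>auto simp: weight_def intro!: exI[of _ a]\<close>)
qed

context
  fixes S :: "point set" and c g :: int
  assumes fin: "finite S" and g: "0 \<le> g" "g \<le> c"
begin

lemma label_greatest: "attains S c g up p v \<Longrightarrow> v \<le> label S c g up p"
  unfolding label_def
  by (rule Greatest_le_nat[where b = "card S"], assumption) (rule attains_le_card[OF fin g])

lemma attains_label: "p \<in> S \<Longrightarrow> attains S c g up p (label S c g up p)"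
  unfolding label_def
  by (rule GreatestI_nat[where b = "card S" and k = 1], rule attains_1, assumption) (rule attains_le_card[OF fin g])

lemma label_ge_1: "p \<in> S \<Longrightarrow> 1 \<le> label S c g up p"
  by (rule label_greatest[OF attains_1])

lemma label_switch:
  assumes "p \<in> S"
  shows "int (label S c g up p) - (if up then g else c - g) \<le> int (label S c g (\<not> up) p)"
proof -
  define d where "d = int (label S c g up p) - (if up then g else c - g)"
  have "d \<le> int (label S c g (\<not> up) p)"
  proof (cases "0 \<le> d")
    case True
    then have "nat d \<le> label S c g (\<not> up) p"
      by (intro label_greatest attains_switch[OF fin attains_label[OF assms]]) (simp add: d_def)
    then show ?thesis by linarith
  qed simp
  then show ?thesis by (simp add: d_def)
qed

lemma label_less:
  assumes "p \<in> S" "q \<in> S" "fst p < fst q" "if up then snd p < snd q else snd q < snd p"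
  shows "label S c g up p < label S c g up q"
  using label_greatest[OF attains_append[OF fin attains_label[OF assms(1)] assms(2-4)]] by simp

text \<open>The right one of two points extends paths ending at the left one, upwards or downwards,
  so one of its labels is larger.\<close>

lemma inj_on_labels:
  assumes "generic S"
  shows "inj_on (\<lambda>p. (int (label S c g True p), int (label S c g False p))) S"
proof -
  have "label S c g True p \<noteq> label S c g True q \<or> label S c g False p \<noteq> label S c g False q"
    if "p \<in> S" "q \<in> S" "fst p < fst q" for p q
  proof -
    have "snd p \<noteq> snd q" using assms that unfolding generic_def by auto
    then consider "snd p < snd q" | "snd q < snd p" by linarith
    then show ?thesis
      using label_less[OF that, of True] label_less[OF that, of False] by cases auto
  qed
  note distinct = this
  show ?thesis
  proof (rule inj_onI, rule ccontr)
    fix p q assume pq: "p \<in> S" "q \<in> S" "p \<noteq> q"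
      and eq: "(int (label S c g True p), int (label S c g False p)) = (int (label S c g True q), int (label S c g False q))"
    then have "fst p \<noteq> fst q" using assms unfolding generic_def by auto
    then consider "fst p < fst q" | "fst q < fst p" by linarith
    then show False using distinct[of p q] distinct[of q p] pq eq by cases auto
  qed
qed

text \<open>A chain in phases \<open>i\<close> and \<open>Suc i\<close> pays for one change, so
  length at least \<open>c\<close> leaves at least the other charge as score. This yields
  \<open>g <= A\<close> and \<open>h <= B\<close> for the hexagon.\<close>

lemma label_ge_of_chain:
  assumes "c \<le> int (longest S i (Suc i))" "i \<le> 1" "S \<noteq> {}"
  obtains p where "p \<in> S" "(if odd i then g else c - g) \<le> int (label S c g (odd i) p)"
proof -
  obtain C where C: "phased_chain S i (Suc i) C" "card C = longest S i (Suc i)"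
    by (rule longest_attained[OF fin])
  show thesis
  proof (cases "C = {}")
    case True
    \<comment> \<open>Both charges vanish here, because \<open>0 <= g <= c <= 0\<close>.\<close>
    then have "c \<le> 0" using C assms(1) by simp
    moreover obtain p where "p \<in> S" using assms(3) by blast
    ultimately show thesis using that[of p] g by auto
  next
    case False
    define d where "d = (if odd i then g else c - g)"
    have "int (nat d) \<le> int (card C) - weight c g (Suc i) + weight c g i"
      using g assms(1) C(2) by (auto simp: d_def weight_Suc)
    then obtain p where "p \<in> S" "attains S c g (even (Suc i)) p (nat d)"
      by (rule attains_last_point[OF fin C(1) False assms(2)])
    then have "p \<in> S" "nat d \<le> label S c g (odd i) p" using label_greatest by auto
    then show thesis using that[of p] unfolding d_def[symmetric] by linarith
  qed
qed

end

section \<open>Lattice points in a hexagon\<close>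

text \<open>The corner cut off by the line \<open>x - z = c\<close> from a box with right edge
  \<open>x = c + n\<close>; its columns have 1 to \<open>n\<close> points.\<close>

definition triangle :: "int \<Rightarrow> nat \<Rightarrow> (int \<times> int) set" where
  "triangle c n = {(x, z). 1 \<le> z \<and> z + c \<le> x \<and> x \<le> c + int n}"

lemma finite_triangle: "finite (triangle c n)"
  by (rule finite_subset[of _ "{1 + c..c + int n} \<times> {1..int n}"]) (auto simp: triangle_def)

lemma card_triangle: "2 * card (triangle c n) = n * (n + 1)"
proof (induction n)
  case 0
  have "triangle c 0 = {}" by (auto simp: triangle_def)
  then show ?case by simp
next
  case (Suc n)
  let ?R = "{c + int (Suc n)} \<times> {1..int (Suc n)}"
  have eq: "triangle c (Suc n) = triangle c n \<union> ?R" and dis: "triangle c n \<inter> ?R = {}"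
    by (auto simp: triangle_def)
  have "card ?R = Suc n" by (simp add: card_cartesian_product)
  then have "card (triangle c (Suc n)) = card (triangle c n) + Suc n"
    unfolding eq using finite_triangle dis by (subst card_Un_disjoint) auto
  then show ?case using Suc.IH by simp
qed

text \<open>The strip misses two disjoint corners of the \<open>A\<close> by \<open>B\<close> box,
  triangles with legs \<open>u\<close> and \<open>v\<close>; the conditions in \<open>bnd\<close>
  keep them inside the box.\<close>

lemma card_hexagon:
  fixes A B g h :: int
  assumes W: "W \<subseteq> {1..A} \<times> {1..B}" and strip: "\<And>x z. (x, z) \<in> W \<Longrightarrow> x - z \<le> g \<and> z - x \<le> h"
    and bnd: "0 \<le> g" "0 \<le> h" "g \<le> A" "h \<le> B" "A - B \<le> g" "B - A \<le> h"
  shows "4 * int (card W) \<le> (g + h + 1) * (2 * (A + B) - (g + h + 1)) + 1"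
proof -
  define u v where "u = A - 1 - g" and "v = B - 1 - h"
  define X where "X = triangle (g + 1) (nat u)"
  define Y where "Y = prod.swap ` triangle (h + 1) (nat v)"
  \<comment> \<open>The value \<open>w = -1\<close> occurs for \<open>A = g\<close> or
    \<open>B = h\<close>; there \<open>nat\<close> gives 0 and \<open>w * (w + 1)\<close> vanishes
    too.\<close>
  have tri: "2 * int (card (triangle c (nat w))) = w * (w + 1)" if "-1 \<le> w" for c w
  proof -
    have "2 * int (card (triangle c (nat w))) = int (nat w) * (int (nat w) + 1)"
      using card_triangle[of c "nat w"] by (metis of_nat_1 of_nat_add of_nat_mult of_nat_numeral)
    also have "\<dots> = w * (w + 1)" using that by (cases "w = -1") simp_all
    finally show ?thesis .
  qed
  have X: "2 * int (card X) = u * (u + 1)" unfolding X_def using bnd by (intro tri) (simp add: u_def)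
  have "card Y = card (triangle (h + 1) (nat v))" unfolding Y_def by (intro card_image) auto
  then have Y: "2 * int (card Y) = v * (v + 1)" using tri[of v] bnd by (simp add: v_def)
  have finX: "finite X" and finY: "finite Y" by (simp_all add: X_def Y_def finite_triangle)
  have sX: "X \<subseteq> {1..A} \<times> {1..B}"
    using bnd by (auto simp: X_def triangle_def u_def)
  have sY: "Y \<subseteq> {1..A} \<times> {1..B}"
    using bnd by (auto simp: Y_def triangle_def v_def)
  have WX: "W \<inter> X = {}" using strip by (force simp: X_def triangle_def)
  have WY: "W \<inter> Y = {}" using strip by (force simp: Y_def triangle_def)
  have XY: "X \<inter> Y = {}" using bnd by (auto simp: X_def Y_def triangle_def)
  have finW: "finite W" using W by (rule finite_subset) auto
  have "card W + card X + card Y = card (W \<union> X \<union> Y)"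
    using finW finX finY WX WY XY by (subst card_Un_disjoint, auto)+
  also have "\<dots> \<le> card ({1..A} \<times> {1..B})"
    using W sX sY by (intro card_mono) auto
  also have "\<dots> = nat A * nat B" by (simp add: card_cartesian_product)
  finally have "int (card W) + int (card X) + int (card Y) \<le> int (nat A * nat B)" by linarith
  also have "int (nat A * nat B) = A * B" using bnd by simp
  finally have le: "4 * int (card W) \<le> 4 * (A * B) - 2 * (u * (u + 1)) - 2 * (v * (v + 1))"
    using X Y by linarith
  \<comment> \<open>The slack is a sum of two squares, so a bound in terms of \<open>A + B\<close>
    and \<open>g + h\<close> alone holds.\<close>
  have "(g + h + 1) * (2 * (A + B) - (g + h + 1)) + 1 - (4 * (A * B) - 2 * (u * (u + 1)) - 2 * (v * (v + 1)))
      = (A - B)\<^sup>2 + (u - v)\<^sup>2"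
    by (simp add: u_def v_def power2_eq_square algebra_simps)
  moreover have "0 \<le> (A - B)\<^sup>2 + (u - v)\<^sup>2" by simp
  ultimately show ?thesis using le by linarith
qed

section \<open>Choice of the charge and the main inequality\<close>

text \<open>Any element of \<open>Q\<close> bounds \<open>P\<close> from above, so
  \<open>Sup P\<close> separates the two sets, even if they are infinite. It will serve as the
  charge \<open>g\<close>.\<close>

lemma exists_between_int_sets:
  fixes P Q :: "int set"
  assumes "P \<noteq> {}" "Q \<noteq> {}" "\<And>p q. p \<in> P \<Longrightarrow> q \<in> Q \<Longrightarrow> p \<le> q"
  obtains g where "\<And>p. p \<in> P \<Longrightarrow> p \<le> g" "\<And>q. q \<in> Q \<Longrightarrow> g \<le> q"
proof (rule that[of "Sup P"])
  have "bdd_above P" using assms(2,3) by (meson bdd_above.I ex_in_conv)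
  then show "p \<le> Sup P" if "p \<in> P" for p using that by (rule cSup_upper[rotated])
  show "Sup P \<le> q" if "q \<in> Q" for q using that assms by (intro cSup_least) auto
qed

text \<open>This is the goal with denominators cleared and twice the length of the path replaced by
  the sum over both starting directions.\<close>

lemma card_le_twin_sum:
  assumes gen: "generic S" and ne: "S \<noteq> {}"
  shows "(2 * int k + 1) * (4 * int (card S) - 1) \<le> (twin_sum S k + int k)\<^sup>2"
proof -
  have fin: "finite S" using gen by (simp add: generic_def)
  define c where "c = twin_sum S (Suc k) - twin_sum S k"
  define T where "T = twin_sum S k - int k * c"
  let ?L = "\<lambda>i j. int (longest S i j)"
  have tangent: "twin_sum S m \<le> T + int m * c" for m
    using concave_le_tangent[of "twin_sum S" m k] twin_sum_concave[OF fin]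
    by (simp add: T_def c_def algebra_simps)
  have pair: "?L 0 a + ?L 1 (Suc b) \<le> T + int ((a + b) div 2) * c" if "even (a + b)" for a b
    using longest_pair_le_twin_sum[OF fin that] tangent order_trans by blast
  have same: "?L 0 (2 * a) + ?L 1 (2 * b + 1) \<le> T + (int a + int b) * c" for a b
    using pair[of "2 * a" "2 * b"] by simp
  have opp: "?L 0 (2 * a + 1) + ?L 1 (2 * b + 2) \<le> T + (int a + int b + 1) * c" for a b
  proof -
    have "(2 * a + 1 + (2 * b + 1)) div 2 = a + b + 1" by simp
    then show ?thesis using pair[of "2 * a + 1" "2 * b + 1"] by (simp add: algebra_simps)
  qed
  have c0: "0 \<le> c"
    using longest_mono[OF fin, of 0 0 k "Suc k"] longest_mono[OF fin, of 1 1 "Suc k" "Suc (Suc k)"]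
    by (simp add: c_def twin_sum_def)
  have c_le: "c \<le> twin_sum S 1 - twin_sum S 0"
    using concave_increments[of "twin_sum S" 0 k] twin_sum_concave[OF fin] by (simp add: c_def)
  \<comment> \<open>The first increment of \<open>twin_sum\<close> is
    \<open>?L 0 1 + ?L 1 2 - ?L 0 0 - ?L 1 1\<close>; splitting either two-phase chain leaves the
    other as a bound for \<open>c\<close>.\<close>
  have "longest S 0 1 \<le> longest S 0 0 + longest S 1 1" "longest S 1 2 \<le> longest S 1 1 + longest S 0 0"
    using longest_split[OF fin, of 0 0 1] longest_split[OF fin, of 1 1 2] longest_shift[OF fin, of 0 0]
    by (simp_all add: numeral_2_eq_2)
  then have c_L: "c \<le> ?L 0 1" "c \<le> ?L 1 2"
    using c_le by (simp_all add: twin_sum_def numeral_2_eq_2)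
  txt \<open>
    The elements of \<open>P\<close> and \<open>Q\<close> other than \<open>0\<close> and \<open>c\<close> are the bounds on \<open>g\<close> that keep \<open>A + B \<le> T\<close> when the
    best paths for \<open>A\<close> and \<open>B\<close> both start increasing resp. both start decreasing.
  \<close>
  define P where "P = insert 0 {?L 0 (2 * a) + ?L 0 (2 * b + 1) - (int a + int b) * c - T | a b. True}"
  define Q where "Q = insert c {T + (int a + int b + 1) * c - ?L 1 (2 * a + 2) - ?L 1 (2 * b + 1) | a b. True}"
  have PQ: "p \<le> q" if "p \<in> P" "q \<in> Q" for p q
  proof -
    have 1: "?L 0 (2 * a) + ?L 0 (2 * b + 1) - (int a + int b) * c - T \<le> c" for a b
    proof -
      \<comment> \<open>Raised by two phases, the chain fits into phases from 1 on, so
        \<open>same\<close> applies at the price of one more \<open>c\<close>.\<close>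
      have "?L 0 (2 * b + 1) \<le> ?L 1 (2 * b + 3)"
        using longest_shift[OF fin, of 0 "2 * b + 1"] longest_mono[OF fin, of 1 2 "2 * b + 3" "2 * b + 3"]
        by (simp add: numeral_eq_Suc)
      then show ?thesis using same[of a "b + 1"] by (simp add: algebra_simps numeral_eq_Suc)
    qed
    have 2: "0 \<le> T + (int a + int b + 1) * c - ?L 1 (2 * a + 2) - ?L 1 (2 * b + 1)" for a b
      using same[of "a + 1" b] longest_mono[OF fin, of 0 1 "2 * a + 2" "2 * a + 2"]
      by (simp add: algebra_simps)
    \<comment> \<open>The four lengths are regrouped into two pairs with different starting
      directions.\<close>
    have 3: "?L 0 (2 * a) + ?L 0 (2 * b + 1) - (int a + int b) * c - T
        \<le> T + (int a' + int b' + 1) * c - ?L 1 (2 * a' + 2) - ?L 1 (2 * b' + 1)" for a b a' b'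
      using same[of a b'] opp[of b a'] by (simp add: algebra_simps)
    show ?thesis using that c0 1 2 3 unfolding P_def Q_def by blast
  qed
  obtain g where gP: "\<And>p. p \<in> P \<Longrightarrow> p \<le> g" and gQ: "\<And>q. q \<in> Q \<Longrightarrow> g \<le> q"
    by (rule exists_between_int_sets[of P Q]) (use PQ in \<open>auto simp: P_def Q_def\<close>)
  have g: "0 \<le> g" "g \<le> c" using gP[of 0] gQ[of c] by (auto simp: P_def Q_def)
  have lo: "?L 0 (2 * a) + ?L 0 (2 * b + 1) - (int a + int b) * c - T \<le> g" for a b
    by (rule gP) (auto simp: P_def)
  have hi: "g \<le> T + (int a + int b + 1) * c - ?L 1 (2 * a + 2) - ?L 1 (2 * b + 1)" for a b
    by (rule gQ) (auto simp: Q_def)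
  define X where "X = label S c g True"
  define Z where "Z = label S c g False"
  define A where "A = Max (X ` S)"
  define B where "B = Max (Z ` S)"
  have A: "X p \<le> A" "Z p \<le> B" if "p \<in> S" for p using that fin by (simp_all add: A_def B_def)
  have switch: "int (X p) - g \<le> int (Z p)" "int (Z p) - (c - g) \<le> int (X p)" if "p \<in> S" for p
    using label_switch[OF fin g that, of True] label_switch[OF fin g that, of False]
    by (simp_all add: X_def Z_def)
  have "A \<in> X ` S" unfolding A_def using fin ne by (intro Max_in) auto
  then obtain pA where pA: "pA \<in> S" "A = X pA" by blast
  have "B \<in> Z ` S" unfolding B_def using fin ne by (intro Max_in) auto
  then obtain pB where pB: "pB \<in> S" "B = Z pB" by blast
  have AB: "int A + int B \<le> T"
  proof -
    have "(\<exists>a. int A \<le> ?L 0 (2 * a) - int a * c) \<or> (\<exists>a. int A \<le> ?L 1 (2 * a + 2) - (int a + 1) * c + g)"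
      using attains_up_bound[OF fin attains_label[OF fin g pA(1)]] pA(2) by (simp add: X_def)
    moreover have "(\<exists>a. int B \<le> ?L 0 (2 * a + 1) - int a * c - g) \<or> (\<exists>a. int B \<le> ?L 1 (2 * a + 1) - int a * c)"
      using attains_down_bound[OF fin attains_label[OF fin g pB(1)]] pB(2) by (simp add: Z_def)
    ultimately consider
      a b where "int A \<le> ?L 0 (2 * a) - int a * c" "int B \<le> ?L 0 (2 * b + 1) - int b * c - g"
    | a b where "int A \<le> ?L 0 (2 * a) - int a * c" "int B \<le> ?L 1 (2 * b + 1) - int b * c"
    | a b where "int A \<le> ?L 1 (2 * a + 2) - (int a + 1) * c + g" "int B \<le> ?L 0 (2 * b + 1) - int b * c - g"
    | a b where "int A \<le> ?L 1 (2 * a + 2) - (int a + 1) * c + g" "int B \<le> ?L 1 (2 * b + 1) - int b * c"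
      by blast
    \<comment> \<open>For different starting directions \<open>g\<close> cancels or is absent, so
      \<open>same\<close> and \<open>opp\<close> suffice; equal ones rely on the choice of
      \<open>g\<close>.\<close>
    then show ?thesis
    proof cases
      case (1 a b) then show ?thesis using lo[of a b] by (simp add: algebra_simps)
    next
      case (2 a b) then show ?thesis using same[of a b] by (simp add: algebra_simps)
    next
      case (3 a b) then show ?thesis using opp[of b a] by (simp add: algebra_simps)
    next
      case (4 a b) then show ?thesis using hi[of a b] by (simp add: algebra_simps)
    qed
  qed
  have gA: "g \<le> int A"
  proof -
    obtain p where "p \<in> S" "g \<le> int (X p)"
      by (rule label_ge_of_chain[OF fin g, of 1]) (use c_L ne in \<open>auto simp: X_def numeral_2_eq_2\<close>)
    then show ?thesis using A(1) by fastforce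
  qed
  have hB: "c - g \<le> int B"
  proof -
    obtain p where "p \<in> S" "c - g \<le> int (Z p)"
      by (rule label_ge_of_chain[OF fin g, of 0]) (use c_L ne in \<open>auto simp: Z_def\<close>)
    then show ?thesis using A(2) by fastforce
  qed
  define W where "W = (\<lambda>p. (int (X p), int (Z p))) ` S"
  have "card W = card S"
    unfolding W_def X_def Z_def by (rule card_image[OF inj_on_labels[OF fin g gen]])
  moreover have "4 * int (card W) \<le> (g + (c - g) + 1) * (2 * (int A + int B) - (g + (c - g) + 1)) + 1"
  proof (rule card_hexagon)
    show "W \<subseteq> {1..int A} \<times> {1..int B}"
      using A label_ge_1[OF fin g] by (auto simp: W_def X_def Z_def)
    show "x - z \<le> g \<and> z - x \<le> c - g" if "(x, z) \<in> W" for x z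
      using that switch by (force simp: W_def)
    show "int A - int B \<le> g" using switch(1)[OF pA(1)] A(2)[OF pA(1)] pA(2) by linarith
    show "int B - int A \<le> c - g" using switch(2)[OF pB(1)] A(1)[OF pB(1)] pB(2) by linarith
  qed (use g gA hB in auto)
  ultimately have "4 * int (card S) - 1 \<le> (c + 1) * (2 * (int A + int B) - (c + 1))" by simp
  also have "\<dots> \<le> (c + 1) * (2 * T - (c + 1))"
    using AB c0 by (intro mult_left_mono) auto
  finally have "(2 * int k + 1) * (4 * int (card S) - 1) \<le> (2 * int k + 1) * ((c + 1) * (2 * T - (c + 1)))"
    by (intro mult_left_mono) auto
  \<comment> \<open>With \<open>y = (2 * k + 1) * (c + 1)\<close> and
    \<open>s = twin_sum S k + k\<close> this is
    \<open>y * (2 * s - y) = s^2 - (y - s)^2\<close>.\<close>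
  also have "\<dots> = (twin_sum S k + int k)\<^sup>2 - ((2 * int k + 1) * (c + 1) - (twin_sum S k + int k))\<^sup>2"
    by (simp add: T_def power2_eq_square algebra_simps)
  also have "\<dots> \<le> (twin_sum S k + int k)\<^sup>2" by simp
  finally show ?thesis .
qed

section \<open>From chains back to modal paths\<close>

text \<open>The parts are the phases, counted from \<open>i\<close>. Keys grow with phases, so
  comparability orders different parts by x-coordinate; the parity of \<open>i\<close> selects the
  alternation pattern.\<close>

lemma modal_path_of_phased_chain:
  assumes gen: "generic S" and C: "phased_chain S i (i + k) C"
  shows "modal_path k (snd ` C)"
proof -
  have finC: "finite C" using C gen by (auto simp: generic_def intro: phased_chain_finite)
  have sub: "snd ` C \<subseteq> S" using C by (auto simp: phased_chain_def)
  have genC: "generic (snd ` C)"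
    using gen sub finC unfolding generic_def by blast
  define A where "A m = snd ` {a \<in> C. fst a = i + m}" for m
  have finA: "finite (A m)" for m using finC by (simp add: A_def)
  have un: "snd ` C = (\<Union>m\<le>k. A m)"
  proof -
    have "\<exists>m\<le>k. fst a = i + m" if "a \<in> C" for a
      using phased_chain_memD[OF C that] by (intro exI[of _ "fst a - i"]) auto
    then show ?thesis by (force simp: A_def)
  qed
  have "vertical_partition k (snd ` C) A"
    unfolding vertical_partition_def
  proof (intro conjI allI impI un)
    fix m n assume mn: "m < n \<and> n \<le> k"
    show "(SUP p\<in>A m. ereal (fst p)) < (INF q\<in>A n. ereal (fst q))"
      unfolding SUP_less_INF_finite_iff[OF finA finA]
    proof (intro ballI)
      fix p q assume "p \<in> A m" "q \<in> A n"
      then have pq: "(i + m, p) \<in> C" "(i + n, q) \<in> C" by (auto simp: A_def)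
      have "key (i + m, p) < key (i + n, q)" using mn by (intro key_less_if_fst_less) simp
      then have "prec (i + m, p) (i + n, q)" using phased_chain_compare[OF C pq] by auto
      then show "fst p < fst q" by (simp add: prec_def)
    qed
  qed
  moreover have inc: "increasing_path (A m)" if "even (i + m)" for m
    unfolding increasing_path_def
  proof (intro conjI finA ballI impI)
    fix p q assume "p \<in> A m" "q \<in> A m" and le: "p \<noteq> q \<and> fst p \<le> fst q"
    then have "(i + m, p) \<in> C" "(i + m, q) \<in> C" by (auto simp: A_def)
    then have "prec (i + m, p) (i + m, q) \<or> prec (i + m, q) (i + m, p)"
      using C le unfolding phased_chain_def by (metis Pair_inject)
    then show "fst p < fst q" "snd p < snd q"
      using le that by (auto simp: prec_def key_def less_prod_def)
  qed
  moreover have dec: "decreasing_path (A m)" if "odd (i + m)" for m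
    unfolding decreasing_path_def
  proof (intro conjI finA ballI impI)
    fix p q assume "p \<in> A m" "q \<in> A m" and le: "p \<noteq> q \<and> fst p \<le> fst q"
    then have "(i + m, p) \<in> C" "(i + m, q) \<in> C" by (auto simp: A_def)
    then have "prec (i + m, p) (i + m, q) \<or> prec (i + m, q) (i + m, p)"
      using C le unfolding phased_chain_def by (metis Pair_inject)
    then show "fst p < fst q" "snd p > snd q"
      using le that by (auto simp: prec_def key_def less_prod_def)
  qed
  ultimately show ?thesis
    unfolding modal_path_def using genC by (cases "even i") (metis even_add)+
qed

lemma modal_path_of_length_longest:
  assumes "generic S"
  obtains P where "P \<subseteq> S" "modal_path k P" "card P = longest S i (i + k)"
proof -
  have fin: "finite S" using assms by (simp add: generic_def)
  obtain C where C: "phased_chain S i (i + k) C" "card C = longest S i (i + k)"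
    by (rule longest_attained[OF fin])
  show thesis
  proof (rule that)
    show "snd ` C \<subseteq> S" using C(1) by (auto simp: phased_chain_def)
    show "modal_path k (snd ` C)" by (rule modal_path_of_phased_chain[OF assms C(1)])
    show "card (snd ` C) = longest S i (i + k)"
      using C card_image[OF phased_chain_inj_on_snd] by metis
  qed
qed

theorem theorem3:
  fixes k :: nat and S :: "point set"
  assumes "generic S" and "S \<noteq> {}"
  shows "\<exists>P. P \<subseteq> S \<and> modal_path k P \<and>
    int (card P) \<ge> \<lceil>sqrt ((2 * real k + 1) * (real (card S) - 1 / 4)) - real k / 2\<rceil>"
proof -
  \<comment> \<open>The better starting direction is taken, so \<open>twin_sum S k\<close> is at
    most twice the length obtained.\<close>
  define i where "i = (if longest S 1 (Suc k) \<le> longest S 0 k then 0 else 1 :: nat)"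
  obtain P where P: "P \<subseteq> S" "modal_path k P" "card P = longest S i (i + k)"
    by (rule modal_path_of_length_longest[OF assms(1)])
  have "twin_sum S k \<le> 2 * int (card P)"
    unfolding P(3) by (auto simp: twin_sum_def i_def)
  then have "(twin_sum S k + int k)\<^sup>2 \<le> (2 * int (card P) + int k)\<^sup>2"
    by (intro power_mono) (auto simp: twin_sum_def)
  then have "(2 * int k + 1) * (4 * int (card S) - 1) \<le> (2 * int (card P) + int k)\<^sup>2"
    using card_le_twin_sum[OF assms, of k] by linarith
  then have "real_of_int ((2 * int k + 1) * (4 * int (card S) - 1)) \<le> real_of_int ((2 * int (card P) + int k)\<^sup>2)"
    by linarith
  then have "(2 * real k + 1) * (real (card S) - 1 / 4) \<le> (real (card P) + real k / 2)\<^sup>2"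
    by (simp add: power2_eq_square field_simps)
  then have "sqrt ((2 * real k + 1) * (real (card S) - 1 / 4)) \<le> real (card P) + real k / 2"
    by (rule real_le_lsqrt[rotated]) simp
  then have "\<lceil>sqrt ((2 * real k + 1) * (real (card S) - 1 / 4)) - real k / 2\<rceil> \<le> int (card P)"
    by (simp add: ceiling_le_iff)
  then show ?thesis using P by blast
qed

end
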